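(* Let $d\ge1$, $n\ge2$, let $X=\{x_1,\dots,x_n\}\subset\mathbb{R}^d$ be distinct points, let $1\le q\le n$, let $\varphi_1,\dots,\varphi_q\colon\mathbb{R}^d\to\mathbb{R}$ be functions, let $V(X)\in\mathbb{R}^{n\times q}$ be the matrix with entries $(V(X))_{i,j}=\varphi_j(x_i)$, and let $Y=(y_1,\dots,y_n)\in\mathbb{R}^n$. Let $K(x,y)=\Phi(x-y)$, $x,y\in\mathbb{R}^d$, be a positive-definite kernel, where $\Phi\colon\mathbb{R}^d\to\mathbb{R}$ is continuous and integrable and there are constants $C_1,C_2>0$ and $\alpha>d/2$ such that $C_1(1+\|\xi\|^2)^{-\alpha}\le\widehat\Phi(\xi)\le C_2(1+\|\xi\|^2)^{-\alpha}$ for all $\xi\in\mathbb{R}^d$. For $\lambda>0$ and $\beta\in\mathbb{R}^q$ let $K_\lambda(x,y)=\Phi((x-y)/\lambda)$ and $$\ell(\lambda,\beta\mid Y)=(Y-V(X)\beta)^{\mathsf T}K_\lambda(X,X)^{-1}(Y-V(X)\beta)+\log\det K_\lambda(X,X).$$ If there exist constants $c\in\mathbb{R}$ and $\beta^*=(\beta_1^*,\dots,\beta_q^* )\in\mathbb{R}^q$ such that $$y_i-\sum_{j=1}^q\beta_j^*\varphi_j(x_i)=c\quad\text{for every } i=1,\dots,n,$$ then $$\lambda_{\mathrm{ML}}=\infty\quad\text{if}\quad\{\lambda_{\mathrm{ML}},\beta_{\mathrm{ML}}\}\in\arg\min_{\lambda>0,\ \beta\in\mathbb{R}^q}\ell(\lambda,\beta\mid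 Y).$$
   Context: A kernel is a symmetric function $K\colon\mathbb{R}^d\times\mathbb{R}^d\to\mathbb{R}$; it is (strictly) positive-definite if $\sum_{i,j}a_ia_jK(z_i,z_j)>0$ for all $N\in\mathbb{N}$, all non-zero $a\in\mathbb{R}^N$ and all distinct $z_1,\dots,z_N$. $K_\lambda(X,X)=(K_\lambda(x_i,x_j))_{i,j=1}^n$. The Fourier transform is $\widehat f(\xi)=\int_{\mathbb{R}^d}f(x)e^{-\mathrm{i}\xi^{\mathsf T}x}\,dx$. Convention: $\lambda_{\mathrm{ML}}=\infty$ means that every sequence $(\lambda_k,\beta_k)$ in $(0,\infty)\times\mathbb{R}^q$ with $\ell(\lambda_k,\beta_k\mid Y)\to\inf_{\lambda>0,\beta\in\mathbb{R}^q}\ell(\lambda,\beta\mid Y)$ satisfies $\lambda_k\to\infty$. *)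

theory Defs
  imports "HOL-Analysis.Analysis"
begin

definition symmetric_kernel :: "('a \<Rightarrow> 'a \<Rightarrow> real) \<Rightarrow> bool" where
  "symmetric_kernel K \<longleftrightarrow> (\<forall>u v. K u v = K v u)"

text \<open>``Positive-definite'' is meant in the strict sense.\<close>

definition positive_definite_kernel :: "('a \<Rightarrow> 'a \<Rightarrow> real) \<Rightarrow> bool" where
  "positive_definite_kernel K \<longleftrightarrow>
     symmetric_kernel K \<and>
     (\<forall>(N::nat) (a :: nat \<Rightarrow> real) (z :: nat \<Rightarrow> 'a).
        (\<exists>i<N. a i \<noteq> 0) \<and> inj_on z {..<N} \<longrightarrow>
        (\<Sum>i<N. \<Sum>j<N. a i * a j * K (z i) (z j)) > 0)"

text \<open>
  If the translation kernel of a function is symmetric, the function is even and its Fourier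
  transform is real-valued; bounds on the transform are then bounds on its real part.
\<close>

definition fourier_transform :: "('a::euclidean_space \<Rightarrow> real) \<Rightarrow> 'a \<Rightarrow> complex" where
  "fourier_transform f \<xi> =
     (LINT x|lborel. complex_of_real (f x) * exp (- (\<i> * complex_of_real (\<xi> \<bullet> x))))"

definition scaled_kernel ::
  "('a::real_vector \<Rightarrow> real) \<Rightarrow> real \<Rightarrow> 'a \<Rightarrow> 'a \<Rightarrow> real" where
  "scaled_kernel \<Phi> lam u v = \<Phi> ((u - v) /\<^sub>R lam)"

definition kernel_matrix ::
  "('a \<Rightarrow> 'a \<Rightarrow> real) \<Rightarrow> ('n \<Rightarrow> 'a) \<Rightarrow> real ^ 'n ^ 'n" where
  "kernel_matrix K x = (\<chi> i j. K (x i) (x j))"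

definition design_matrix ::
  "('q \<Rightarrow> 'a \<Rightarrow> real) \<Rightarrow> ('n \<Rightarrow> 'a) \<Rightarrow> real ^ 'q ^ 'n" where
  "design_matrix \<phi> x = (\<chi> i j. \<phi> j (x i))"

definition ml_objective ::
  "('a::real_vector \<Rightarrow> real) \<Rightarrow> ('q::finite \<Rightarrow> 'a \<Rightarrow> real) \<Rightarrow> ('n::finite \<Rightarrow> 'a) \<Rightarrow>
   real ^ 'n \<Rightarrow> real \<Rightarrow> real ^ 'q \<Rightarrow> real" where
  "ml_objective \<Phi> \<phi> x Y lam \<beta> =
     (Y - design_matrix \<phi> x *v \<beta>) \<bullet>
       (matrix_inv (kernel_matrix (scaled_kernel \<Phi> lam) x) *v (Y - design_matrix \<phi> x *v \<beta>))
     + ln (det (kernel_matrix (scaled_kernel \<Phi> lam) x))"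

text \<open>
  The maximum likelihood scale is said to be infinite if the scales of every minimising
  sequence of the objective tend to infinity. The infimum is taken in the extended reals,
  since the objective may be unbounded below.
\<close>

definition ml_scale_infinite :: "(real \<Rightarrow> 'b \<Rightarrow> real) \<Rightarrow> bool" where
  "ml_scale_infinite l \<longleftrightarrow>
     (\<forall>(lam :: nat \<Rightarrow> real) (\<beta> :: nat \<Rightarrow> 'b).
        (\<forall>k. lam k > 0) \<and>
        (\<lambda>k. ereal (l (lam k) (\<beta> k)))
          \<longlonglongrightarrow> (INF (t, b) \<in> {0<..} \<times> UNIV. ereal (l t b))
        \<longrightarrow> filterlim lam at_top sequentially)"

end

theory Submission
  imports Defs "HOL-Probability.Characteristic_Functions"
begin

text \<open>
  Two facts about the objective suffice: it is unbounded below, so its infimum is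
  \<open>-\<infinity>\<close>, and it is bounded below on every region \<open>0 < \<lambda> \<le> M\<close>. A minimising sequence must then
  leave each of these regions.

  \<^bold>\<open>Bounded below for bounded scales.\<close> The quadratic form of the inverse of a positive definite
  matrix is nonnegative, so only the logarithm of \<open>det K\<^sub>\<lambda>(X,X)\<close> matters. This determinant is
  positive and continuous in \<open>\<lambda>\<close>. A positive definite function that is continuous at \<open>0\<close> is
  uniformly continuous, and a uniformly continuous integrable function vanishes at infinity;
  hence the off-diagonal entries of \<open>K\<^sub>\<lambda>(X,X)\<close> tend to \<open>0\<close> as \<open>\<lambda> \<rightarrow> 0\<close>, and the determinant tends
  to \<open>\<Phi>(0)\<^sup>n > 0\<close>. So it has a positive lower bound on \<open>(0, M]\<close>
  (\<open>det_scaled_matrix_bounded_below\<close>).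

  \<^bold>\<open>Unbounded below at large scales.\<close> At \<open>\<beta> = \<beta>*\<close> the residual is the constant vector with entries
  \<open>c\<close>. As \<open>\<lambda> \<rightarrow> \<infinity>\<close> every entry of \<open>K\<^sub>\<lambda>(X,X)\<close> tends to \<open>\<Phi>(0)\<close>; since \<open>n \<ge> 2\<close> the limit matrix is
  singular and the logarithm of the determinant tends to \<open>-\<infinity>\<close>. It remains to bound the quadratic
  form of the inverse at the constant vector, uniformly in \<open>\<lambda>\<close>. By duality this is the inequality
  \<open>(\<Sum> a\<^sub>i)\<^sup>2 \<le> B \<Sum> a\<^sub>i a\<^sub>j \<Phi>(z\<^sub>i - z\<^sub>j)\<close> with a constant \<open>B\<close> that depends on the number of points but
  neither on the points \<open>z\<^sub>i = x\<^sub>i/\<lambda>\<close> nor on the coefficients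
  (\<open>sum_squared_le_quadratic_form\<close>). It is obtained in two steps, in terms of the exponential sum
  \<open>p(\<xi>) = \<Sum> a\<^sub>i exp(\<i> \<xi> \<bullet> z\<^sub>i)\<close>, for which \<open>p(0) = \<Sum> a\<^sub>i\<close>.

  \<^item> Let \<open>g\<close> be the Gaussian. By Fubini's theorem the integral of \<open>g |p|\<^sup>2 \<Phi>^\<close>, where \<open>\<Phi>^\<close> is the
    Fourier transform of \<open>\<Phi>\<close>, is a constant times the integral of \<open>g F\<close> with
    \<open>F(x) = \<Sum> a\<^sub>i a\<^sub>j \<Phi>(x + z\<^sub>i - z\<^sub>j)\<close>. Positive definiteness gives \<open>|F(x)| \<le> F(0)\<close>, and \<open>F(0)\<close> is the
    quadratic form. Hence the integral of \<open>g |p|\<^sup>2 \<Phi>^\<close> is at most a constant times the quadratic form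
    (\<open>fourier_energy_le_quadratic_form\<close>). A single fixed Gaussian is enough because \<open>F\<close> is
    compared with its maximum \<open>F(0)\<close>.

  \<^item> Along each ray, the samples \<open>p(0), p(\<xi>), \<dots>, p(n\<xi>)\<close> satisfy a linear recurrence whose
    coefficients have absolute values adding up to at most \<open>2\<^sup>n\<close>, so that
    \<open>|p(0)|\<^sup>2 \<le> 4\<^sup>n (|p(\<xi>)|\<^sup>2 + \<dots> + |p(n\<xi>)|\<^sup>2)\<close> (\<open>turan_power_sum\<close>). The lower bound on \<open>\<Phi>^\<close>
    makes \<open>g \<Phi>^\<close> dominate a positive radially decreasing weight; integrating the inequality against
    it bounds \<open>|p(0)|\<^sup>2\<close> by a constant times the integral of \<open>g |p|\<^sup>2 \<Phi>^\<close>.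
\<close>

section \<open>Positive definite functions\<close>

lemma positive_definite_kernel_sum_pos:
  assumes K: "positive_definite_kernel K" and I: "finite I" and inj: "inj_on z I"
    and nz: "\<exists>i\<in>I. a i \<noteq> 0"
  shows "(\<Sum>i\<in>I. \<Sum>j\<in>I. a i * a j * K (z i) (z j)) > 0"
proof -
  obtain h where h: "bij_betw h {0..<card I} I"
    using ex_bij_betw_nat_finite[OF I] by blast
  then have h: "bij_betw h {..<card I} I" by (simp add: lessThan_atLeast0)
  have "(\<Sum>i<card I. \<Sum>j<card I. (a \<circ> h) i * (a \<circ> h) j * K ((z \<circ> h) i) ((z \<circ> h) j)) > 0"
  proof -
    have "\<exists>i<card I. (a \<circ> h) i \<noteq> 0"
      using nz h by (metis bij_betw_iff_bijections comp_apply lessThan_iff)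
    moreover have "inj_on (z \<circ> h) {..<card I}"
      using h inj by (metis bij_betw_def comp_inj_on)
    ultimately show ?thesis using K unfolding positive_definite_kernel_def by blast
  qed
  also have "(\<Sum>i<card I. \<Sum>j<card I. (a \<circ> h) i * (a \<circ> h) j * K ((z \<circ> h) i) ((z \<circ> h) j))
      = (\<Sum>i\<in>I. \<Sum>j\<in>I. a i * a j * K (z i) (z j))"
    by (simp add: sum.reindex_bij_betw[OF h, symmetric])
  finally show ?thesis .
qed

text \<open>
  Points that coincide can be merged by adding their coefficients. The merged coefficients may all
  vanish, which is why strict positivity is lost.
\<close>

lemma positive_definite_kernel_sum_nonneg:
  assumes K: "positive_definite_kernel K" and I: "finite I"
  shows "(\<Sum>i\<in>I. \<Sum>j\<in>I. a i * a j * K (z i) (z j)) \<ge> 0"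
proof -
  \<comment> \<open>the total coefficient carried by the point \<open>p\<close>\<close>
  define A where "A p = (\<Sum>i | i \<in> I \<and> z i = p. a i)" for p
  have fibres: "(\<Sum>i\<in>I. a i * g (z i)) = (\<Sum>p\<in>z ` I. A p * g p)" for g
    unfolding A_def by (subst sum.image_gen[OF I, of _ z]) (simp add: sum_distrib_right)
  have "(\<Sum>i\<in>I. \<Sum>j\<in>I. a i * a j * K (z i) (z j))
      = (\<Sum>i\<in>I. a i * (\<Sum>j\<in>I. a j * K (z i) (z j)))"
    by (simp add: sum_distrib_left mult.assoc)
  also have "\<dots> = (\<Sum>p\<in>z ` I. A p * (\<Sum>q\<in>z ` I. A q * K p q))"
    by (subst fibres)+ simp
  also have "\<dots> = (\<Sum>p\<in>z ` I. \<Sum>q\<in>z ` I. A p * A q * K p q)"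
    by (simp add: sum_distrib_left mult.assoc)
  also have "\<dots> \<ge> 0"
  proof (cases "\<exists>p\<in>z ` I. A p \<noteq> 0")
    case True
    then show ?thesis
      using positive_definite_kernel_sum_pos[OF K, of "z ` I" id A] I by fastforce
  next
    case False
    then have "(\<Sum>p\<in>z ` I. \<Sum>q\<in>z ` I. A p * A q * K p q) = 0"
      by (intro sum.neutral ballI) auto
    then show ?thesis by simp
  qed
  finally show ?thesis .
qed

lemma positive_definite_kernel_even:
  fixes \<Phi> :: "'a::real_vector \<Rightarrow> real"
  assumes K: "positive_definite_kernel (\<lambda>u v. \<Phi> (u - v))"
  shows "\<Phi> (- u) = \<Phi> u"
proof -
  have "\<Phi> (u - 0) = \<Phi> (0 - u)"
    using K unfolding positive_definite_kernel_def symmetric_kernel_def by blast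
  then show ?thesis by simp
qed

text \<open>
  This is the classical bound \<open>|F(s)| \<le> F(0)\<close> for a positive definite function, applied to
  \<open>F(s) = \<Sum> a\<^sub>i a\<^sub>j \<Phi>(s + z\<^sub>i - z\<^sub>j)\<close>, which inherits positive semidefiniteness from \<open>\<Phi>\<close>. The proof
  evaluates the form of \<open>\<Phi>\<close> on the points \<open>z\<^sub>i\<close> together with their translates by \<open>s\<close>, the
  coefficients on the points \<open>z\<^sub>i\<close> themselves being multiplied by \<open>\<plusminus>1\<close>.
\<close>

lemma positive_definite_shifted_sum_bound:
  fixes \<Phi> :: "'a::real_vector \<Rightarrow> real"
  assumes K: "positive_definite_kernel (\<lambda>u v. \<Phi> (u - v))" and I: "finite I"
  shows "\<bar>\<Sum>i\<in>I. \<Sum>j\<in>I. a i * a j * \<Phi> (s + z i - z j)\<bar>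
     \<le> (\<Sum>i\<in>I. \<Sum>j\<in>I. a i * a j * \<Phi> (z i - z j))"
proof -
  define F where "F s = (\<Sum>i\<in>I. \<Sum>j\<in>I. a i * a j * \<Phi> (s + z i - z j))" for s
  note even = positive_definite_kernel_even[OF K]
  have F_minus: "F (- s) = F s" for s
  proof -
    have "F (- s) = (\<Sum>i\<in>I. \<Sum>j\<in>I. a i * a j * \<Phi> (s + z j - z i))"
    proof -
      have "\<Phi> (- s + z i - z j) = \<Phi> (s + z j - z i)" for i j
        using even[of "s + z j - z i"] by (simp add: algebra_simps)
      then show ?thesis by (simp add: F_def)
    qed
    also have "\<dots> = F s"
      unfolding F_def by (subst sum.swap) (simp add: mult.commute)
    finally show ?thesis .
  qed
  \<comment> \<open>The sign \<open>e\<close> is \<open>\<plusminus>1\<close>; the two copies of \<open>I\<close> index the translated and the original points.\<close>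
  have "0 \<le> 2 * F 0 + 2 * e * F s" if e: "e * e = 1" for e
  proof -
    have "0 \<le> (\<Sum>p\<in>I <+> I. \<Sum>q\<in>I <+> I.
        case_sum a (\<lambda>i. e * a i) p * case_sum a (\<lambda>i. e * a i) q
        * \<Phi> (case_sum (\<lambda>i. s + z i) z p - case_sum (\<lambda>i. s + z i) z q))"
      using positive_definite_kernel_sum_nonneg[OF K, of "I <+> I"] I by simp
    also have "\<dots> = (\<Sum>i\<in>I. \<Sum>j\<in>I. a i * a j * \<Phi> ((s + z i) - (s + z j)))
        + (\<Sum>i\<in>I. \<Sum>j\<in>I. a i * (e * a j) * \<Phi> (s + z i - z j))
        + (\<Sum>i\<in>I. \<Sum>j\<in>I. e * a i * a j * \<Phi> (z i - (s + z j)))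
        + (\<Sum>i\<in>I. \<Sum>j\<in>I. e * a i * (e * a j) * \<Phi> (z i - z j))"
      using I by (simp add: sum.Plus sum.distrib)
    also have "\<dots> = F 0 + e * F s + e * F (- s) + (e * e) * F 0"
      unfolding F_def sum_distrib_left
      by (simp add: diff_diff_eq ac_simps)
    finally show ?thesis using e by (simp add: F_minus)
  qed
  from this[of 1] this[of "-1"] show ?thesis
    unfolding F_def by (simp add: abs_le_iff)
qed

lemma positive_definite_kernel_at_0:
  fixes \<Phi> :: "'a::real_vector \<Rightarrow> real"
  assumes K: "positive_definite_kernel (\<lambda>u v. \<Phi> (u - v))"
  shows "\<Phi> 0 > 0"
  using positive_definite_kernel_sum_pos[OF K, of "{()}" "\<lambda>_. 0" "\<lambda>_. 1"] by simp

text \<open>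
  Krein's inequality: the form on the points \<open>u\<close>, \<open>v\<close>, \<open>0\<close> with coefficients \<open>1\<close>, \<open>-1\<close>, \<open>t\<close> is a
  nonnegative quadratic polynomial in \<open>t\<close>, evaluated at its minimum.
\<close>

lemma positive_definite_increment_bound:
  fixes \<Phi> :: "'a::real_vector \<Rightarrow> real"
  assumes K: "positive_definite_kernel (\<lambda>u v. \<Phi> (u - v))"
  shows "(\<Phi> u - \<Phi> v)\<^sup>2 \<le> 2 * \<Phi> 0 * (\<Phi> 0 - \<Phi> (u - v))"
proof -
  note even = positive_definite_kernel_even[OF K]
  note \<Phi>0 = positive_definite_kernel_at_0[OF K]
  \<comment> \<open>the minimiser of the quadratic polynomial in \<open>t\<close>\<close>
  define t where "t = - (\<Phi> u - \<Phi> v) / \<Phi> 0"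
  define z where "z i = (if i = 0 then u else if i = 1 then v else 0)" for i :: nat
  define a where "a i = (if i = 0 then 1 else if i = 1 then -1 else t)" for i :: nat
  have "0 \<le> (\<Sum>i\<in>{0,1,2}. \<Sum>j\<in>{0,1,2}. a i * a j * \<Phi> (z i - z j))"
    by (rule positive_definite_kernel_sum_nonneg[OF K]) simp
  also have "\<dots> = 2 * (\<Phi> 0 - \<Phi> (u - v)) + 2 * t * (\<Phi> u - \<Phi> v) + t * t * \<Phi> 0"
    using even[of "u - v"] by (simp add: z_def a_def even algebra_simps)
  also have "\<dots> = 2 * (\<Phi> 0 - \<Phi> (u - v)) - (\<Phi> u - \<Phi> v)\<^sup>2 / \<Phi> 0"
    using \<Phi>0 by (simp add: t_def power2_eq_square field_simps)
  finally show ?thesis using \<Phi>0 by (simp add: field_simps)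
qed

lemma positive_definite_uniformly_continuous:
  fixes \<Phi> :: "'a::real_normed_vector \<Rightarrow> real"
  assumes K: "positive_definite_kernel (\<lambda>u v. \<Phi> (u - v))" and cont: "isCont \<Phi> 0"
  shows "uniformly_continuous_on UNIV \<Phi>"
  unfolding uniformly_continuous_on_def
proof (intro allI impI)
  fix e :: real assume e: "e > 0"
  note \<Phi>0 = positive_definite_kernel_at_0[OF K]
  have "e\<^sup>2 / (2 * \<Phi> 0) > 0" using e \<Phi>0 by simp
  then obtain d where d: "d > 0" "\<And>u. norm u < d \<Longrightarrow> \<bar>\<Phi> u - \<Phi> 0\<bar> < e\<^sup>2 / (2 * \<Phi> 0)"
    using cont unfolding continuous_at_eps_delta dist_norm real_norm_def by (metis diff_zero)
  have "dist (\<Phi> v) (\<Phi> u) < e" if "dist v u < d" for u v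
  proof -
    have "(\<Phi> v - \<Phi> u)\<^sup>2 \<le> 2 * \<Phi> 0 * (\<Phi> 0 - \<Phi> (v - u))"
      by (rule positive_definite_increment_bound[OF K])
    also have "\<dots> < 2 * \<Phi> 0 * (e\<^sup>2 / (2 * \<Phi> 0))"
      using d(2)[of "v - u"] that \<Phi>0 by (intro mult_strict_left_mono) (auto simp: dist_norm)
    also have "\<dots> = e\<^sup>2" using \<Phi>0 by simp
    finally have "\<bar>\<Phi> v - \<Phi> u\<bar>\<^sup>2 < e\<^sup>2" by simp
    then show ?thesis using e by (simp add: dist_real_def power2_less_imp_less del: power2_abs)
  qed
  with d(1) show "\<exists>d>0. \<forall>u\<in>UNIV. \<forall>v\<in>UNIV. dist v u < d \<longrightarrow> dist (\<Phi> v) (\<Phi> u) < e" by blast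
qed

section \<open>A Turan-type inequality for power sums\<close>

text \<open>
  The \<open>c\<^sub>k\<close> are the coefficients of the polynomial \<open>\<Prod>(1 - x/w\<^sub>i)\<close>, which vanishes at every \<open>w\<^sub>i\<close>. Since
  \<open>|w\<^sub>i| = 1\<close>, each factor at most doubles the sum of the absolute values of the coefficients. The
  clause on the coefficients beyond the degree is there for the induction.
\<close>

lemma unimodular_power_sum_bound:
  fixes w :: "'i \<Rightarrow> complex"
  assumes "finite I" and "\<And>i. i \<in> I \<Longrightarrow> cmod (w i) = 1"
  shows "\<exists>c. c 0 = 1 \<and> (\<forall>k>card I. c k = 0) \<and> (\<Sum>k\<le>card I. cmod (c k)) \<le> 2 ^ card I
     \<and> (\<forall>i\<in>I. (\<Sum>k\<le>card I. c k * w i ^ k) = 0)"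
  using assms
proof (induction I rule: finite_induct)
  case empty
  show ?case by (rule exI[of _ "\<lambda>k. if k = 0 then 1 else 0"]) simp
next
  case (insert l I)
  then obtain c where c: "c 0 = 1" "\<forall>k>card I. c k = 0" "(\<Sum>k\<le>card I. cmod (c k)) \<le> 2 ^ card I"
     "\<forall>i\<in>I. (\<Sum>k\<le>card I. c k * w i ^ k) = 0" by auto
  define v where "v = inverse (w l)"
  have l: "cmod v = 1" "w l * v = 1" using insert.prems[of l] 
    by (auto simp: v_def norm_inverse intro!: right_inverse)
  \<comment> \<open>coefficients after multiplication by the factor \<open>1 - v x\<close>\<close>
  define c' where "c' k = c k - (if k = 0 then 0 else v * c (k - 1))" for k
  let ?n = "card I"
  have cS: "c (Suc ?n) = 0" using c(2) by simp
  have eq: "(\<Sum>k\<le>Suc ?n. c' k * x ^ k) = (1 - v * x) * (\<Sum>k\<le>?n. c k * x ^ k)" for x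
  proof -
    have "(\<Sum>k\<le>Suc ?n. c' k * x ^ k) = (\<Sum>k\<le>Suc ?n. c k * x ^ k)
       - (\<Sum>k\<le>Suc ?n. (if k = 0 then 0 else v * c (k - 1)) * x ^ k)"
      by (simp only: c'_def left_diff_distrib sum_subtractf)
    also have "(\<Sum>k\<le>Suc ?n. (if k = 0 then 0 else v * c (k - 1)) * x ^ k)
        = (\<Sum>k\<le>?n. v * c k * x ^ Suc k)"
      by (subst sum.atMost_Suc_shift) simp
    also have "(\<Sum>k\<le>Suc ?n. c k * x ^ k) = (\<Sum>k\<le>?n. c k * x ^ k)" by (simp add: cS)
    also have "(\<Sum>k\<le>?n. v * c k * x ^ Suc k) = v * x * (\<Sum>k\<le>?n. c k * x ^ k)"
      by (simp add: sum_distrib_left mult_ac)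
    finally show ?thesis by (simp only: left_diff_distrib mult_1)
  qed
  have "(\<Sum>k\<le>Suc ?n. cmod (c' k)) \<le> (\<Sum>k\<le>Suc ?n. cmod (c k) + (if k = 0 then 0 else cmod (c (k - 1))))"
    by (intro sum_mono) (auto simp: c'_def norm_mult l intro: order_trans[OF norm_triangle_ineq4])
  also have "\<dots> = (\<Sum>k\<le>?n. cmod (c k)) + (\<Sum>k\<le>Suc ?n. (if k = 0 then 0 else cmod (c (k - 1))))"
    by (simp add: sum.distrib cS)
  also have "(\<Sum>k\<le>Suc ?n. (if k = 0 then 0 else cmod (c (k - 1)))) = (\<Sum>k\<le>?n. cmod (c k))"
    by (subst sum.atMost_Suc_shift) simp
  finally have 1: "(\<Sum>k\<le>Suc ?n. cmod (c' k)) \<le> 2 ^ Suc ?n" using c(3) by simp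
  have 2: "\<forall>i\<in>insert l I. (\<Sum>k\<le>Suc ?n. c' k * w i ^ k) = 0"
    unfolding eq using l(2) c(4) by (auto simp: mult.commute)
  have 3: "c' 0 = 1" "\<forall>k>Suc ?n. c' k = 0" using c(1,2) by (auto simp: c'_def)
  show ?case
    unfolding card_insert_disjoint[OF insert.hyps] using 1 2 3 by blast
qed

text \<open>
  The relations \<open>\<Sum> c\<^sub>k w\<^sub>i\<^sup>k = 0\<close>, summed with the weights \<open>a\<^sub>i\<close>, express the zeroth power sum through
  the next ones, with coefficients whose absolute values add up to at most \<open>2\<^sup>n\<close>. What matters later
  is that the constant does not depend on the position of the \<open>w\<^sub>i\<close> on the unit circle, even when
  they come close to each other.
\<close>

lemma turan_power_sum:
  fixes w :: "'i \<Rightarrow> complex" and a :: "'i \<Rightarrow> complex"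
  assumes I: "finite I" and w: "\<And>i. i \<in> I \<Longrightarrow> cmod (w i) = 1"
  shows "(cmod (\<Sum>i\<in>I. a i))\<^sup>2 \<le> 4 ^ card I * (\<Sum>k=1..card I. (cmod (\<Sum>i\<in>I. a i * w i ^ k))\<^sup>2)"
proof -
  let ?n = "card I"
  define p where "p k = (\<Sum>i\<in>I. a i * w i ^ k)" for k
  \<comment> \<open>a common bound for all \<open>|p k|\<close> with \<open>1 \<le> k \<le> n\<close>\<close>
  define M where "M = sqrt (\<Sum>k=1..?n. (cmod (p k))\<^sup>2)"
  have M0: "M \<ge> 0" by (simp add: M_def sum_nonneg)
  obtain c where c: "c 0 = 1" "(\<Sum>k\<le>?n. cmod (c k)) \<le> 2 ^ ?n"
     "\<forall>i\<in>I. (\<Sum>k\<le>?n. c k * w i ^ k) = 0" using unimodular_power_sum_bound[of I w] assms by blast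
  have split: "(\<Sum>k\<le>?n. g k) = g 0 + (\<Sum>k=1..?n. g k)" for g :: "nat \<Rightarrow> 'b::comm_monoid_add"
    by (simp add: atMost_atLeast0 sum.atLeast_Suc_atMost)
  have "(\<Sum>k\<le>?n. c k * p k) = (\<Sum>i\<in>I. a i * (\<Sum>k\<le>?n. c k * w i ^ k))"
    unfolding p_def sum_distrib_left by (subst sum.swap) (simp add: algebra_simps)
  also have "\<dots> = 0" using c(3) by simp
  finally have "p 0 = - (\<Sum>k=1..?n. c k * p k)"
    unfolding split using c(1) by (simp add: eq_neg_iff_add_eq_0)
  then have "cmod (p 0) \<le> (\<Sum>k=1..?n. cmod (c k) * cmod (p k))"
    by (simp add: norm_mult[symmetric] norm_sum)
  also have "\<dots> \<le> (\<Sum>k=1..?n. cmod (c k) * M)"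
  proof (intro sum_mono mult_left_mono)
    fix k assume k: "k \<in> {1..?n}"
    show "cmod (p k) \<le> M"
      unfolding M_def by (rule real_le_rsqrt) (use k in \<open>auto intro!: member_le_sum\<close>)
  qed auto
  also have "\<dots> = (\<Sum>k=1..?n. cmod (c k)) * M" by (simp add: sum_distrib_right)
  also have "\<dots> \<le> 2 ^ ?n * M"
    by (intro mult_right_mono M0 order_trans[OF _ c(2)]) (auto intro!: sum_mono2)
  finally have "(cmod (p 0))\<^sup>2 \<le> (2 ^ ?n * M)\<^sup>2" by (intro power_mono) auto
  also have "\<dots> = 4 ^ ?n * (\<Sum>k=1..?n. (cmod (p k))\<^sup>2)"
  proof -
    have "((2::real) ^ ?n)\<^sup>2 = 4 ^ ?n"
      by (simp add: power2_eq_square power_mult_distrib[symmetric])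
    then show ?thesis by (simp add: power_mult_distrib M_def sum_nonneg)
  qed
  finally show ?thesis by (simp add: p_def)
qed

section \<open>Lebesgue integration on Euclidean space\<close>

lemma has_bochner_integral_lborel_prod:
  fixes f :: "'a::euclidean_space \<Rightarrow> real \<Rightarrow> complex"
  assumes f: "\<And>b. b \<in> Basis \<Longrightarrow> integrable lborel (f b)"
  shows "has_bochner_integral lborel (\<lambda>x::'a. \<Prod>b\<in>Basis. f b (x \<bullet> b))
     (\<Prod>b\<in>Basis. LINT t|lborel. f b t)"
proof -
  interpret product_sigma_finite "\<lambda>_::'a. lborel :: real measure" by unfold_locales
  have [measurable]: "b \<in> Basis \<Longrightarrow> f b \<in> borel_measurable borel" for b
    using borel_measurable_integrable[OF f] by simp
  have coord: "(\<Sum>c\<in>Basis. g c *\<^sub>R c) \<bullet> b = g b" if "b \<in> Basis" for g :: "'a \<Rightarrow> real" and b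
    using that by (simp add: inner_sum_left inner_Basis if_distrib cong: if_cong)
  have eq: "(\<Prod>b\<in>Basis. f b ((\<Sum>c\<in>Basis. g c *\<^sub>R c) \<bullet> b)) = (\<Prod>b\<in>Basis. f b (g b))" for g
    by (intro prod.cong refl) (simp add: coord)
  have "integrable lborel (\<lambda>x::'a. \<Prod>b\<in>Basis. f b (x \<bullet> b))"
    by (subst lborel_eq, subst integrable_distr_eq)
       (auto simp: eq intro!: product_integrable_prod f)
  moreover have "(LINT x|lborel. (\<Prod>b\<in>Basis. f b ((x::'a) \<bullet> b))) = (\<Prod>b\<in>Basis. LINT t|lborel. f b t)"
    by (subst lborel_eq, subst integral_distr)
       (auto simp: eq intro!: product_integral_prod f)
  ultimately show ?thesis by (simp add: has_bochner_integral_iff)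
qed

lemma has_bochner_integral_lborel_translate:
  fixes f :: "'a::euclidean_space \<Rightarrow> real"
  assumes "has_bochner_integral lborel f I"
  shows "has_bochner_integral lborel (\<lambda>x. f (x + c)) I"
proof -
  have "has_bochner_integral (distr lborel borel (\<lambda>x. c + x)) f I"
    using assms lborel_distr_plus[of c] by (simp add: has_bochner_integral_iff)
  then show ?thesis
    using borel_measurable_has_bochner_integral[OF assms]
    by (subst (asm) has_bochner_integral_iff, subst (asm) (1) integrable_distr_eq, simp, simp,
        subst (asm) integral_distr) (simp_all add: has_bochner_integral_iff add.commute)
qed

lemma has_bochner_integral_lborel_scale:
  fixes f :: "'a::euclidean_space \<Rightarrow> real"
  assumes f: "has_bochner_integral lborel f I" and c: "c > 0"
  shows "has_bochner_integral lborel (\<lambda>x. f (c *\<^sub>R x)) (I / c ^ DIM('a))"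
proof -
  have [measurable]: "f \<in> borel_measurable borel"
    using borel_measurable_has_bochner_integral[OF f] by simp
  have lb: "lborel = density (distr lborel borel (\<lambda>x::'a. c *\<^sub>R x)) (\<lambda>_. ennreal (c ^ DIM('a)))"
    using lborel_affine[of c 0] c by simp
  have "integrable lborel f \<longleftrightarrow> integrable lborel (\<lambda>x. c ^ DIM('a) *\<^sub>R f (c *\<^sub>R x))"
    using c by (subst lb, subst integrable_density) (auto simp: integrable_distr_eq)
  moreover have "integral\<^sup>L lborel f = (LINT x|lborel. c ^ DIM('a) *\<^sub>R f (c *\<^sub>R x))"
    using c by (subst lb, subst integral_density) (auto simp: integral_distr)
  ultimately show ?thesis using f c by (simp add: has_bochner_integral_iff field_simps)
qed

lemma lborel_integral_pos:
  fixes f :: "'a::euclidean_space \<Rightarrow> real"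
  assumes f: "integrable lborel f" and pos: "\<And>x. f x > 0"
  shows "(LINT x|lborel. f x) > 0"
proof (rule ccontr)
  assume "\<not> ?thesis"
  then have "(LINT x|lborel. f x) = 0"
    using Bochner_Integration.integral_nonneg[of lborel f] pos by (simp add: less_imp_le antisym)
  then have "AE x in lborel. f x = 0"
    using integral_nonneg_eq_0_iff_AE[OF f] pos by (simp add: less_imp_le)
  then have "AE x::'a in lborel. False"
    by eventually_elim (use pos in \<open>simp add: less_imp_neq[symmetric]\<close>)
  then show False by (simp add: eventually_False ae_filter_eq_bot_iff emeasure_lborel_UNIV)
qed

text \<open>
  If \<open>|f(x)| \<ge> e\<close>, uniform continuity keeps \<open>|f| \<ge> e/2\<close> on a ball about \<open>x\<close> whose radius does not
  depend on \<open>x\<close>. Far away from the origin this contradicts the smallness of the tail integrals of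
  \<open>|f|\<close>.
\<close>

lemma integrable_uniformly_continuous_tendsto_0:
  fixes f :: "'a::euclidean_space \<Rightarrow> real"
  assumes f: "integrable lborel f" and uc: "uniformly_continuous_on UNIV f"
  shows "(f \<longlongrightarrow> 0) at_infinity"
  unfolding tendsto_iff
proof (intro allI impI)
  fix e :: real assume e: "e > 0"
  have [measurable]: "f \<in> borel_measurable borel" using borel_measurable_integrable[OF f] by simp
  obtain d where d: "d > 0" "\<And>u v. dist v u < d \<Longrightarrow> dist (f v) (f u) < e / 2"
    using uniformly_continuous_onE[OF uc, of "e / 2"] e by (metis UNIV_I half_gt_zero)
  define tail where "tail n x = \<bar>f x\<bar> * indicator {x. real n \<le> norm x} x" for n :: nat and x
  have [measurable]: "tail n \<in> borel_measurable borel" for n unfolding tail_def by measurable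
  have tail_int: "integrable lborel (tail n)" for n
    by (rule Bochner_Integration.integrable_bound[OF f]) (auto simp: tail_def indicator_def)
  have "(\<lambda>n. LINT x|lborel. tail n x) \<longlonglongrightarrow> (LINT x::'a|lborel. 0)"
  proof (rule integral_dominated_convergence[where w="\<lambda>x. \<bar>f x\<bar>"])
    show "AE x in lborel. (\<lambda>n. tail n x) \<longlonglongrightarrow> 0"
    proof (rule AE_I2)
      fix x
      have "eventually (\<lambda>n. tail n x = 0) sequentially"
        using eventually_gt_at_top[of "nat \<lceil>norm x\<rceil>"]
        by eventually_elim (simp add: tail_def indicator_def, linarith)
      then show "(\<lambda>n. tail n x) \<longlonglongrightarrow> 0" by (rule tendsto_eventually)
    qed
    show "integrable lborel (\<lambda>x. \<bar>f x\<bar>)" using f by simp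
  qed (auto simp: tail_def indicator_def)
  then have lim: "(\<lambda>n. LINT x|lborel. tail n x) \<longlonglongrightarrow> 0" by simp
  have vol: "measure lborel (ball x d) = unit_ball_vol (real DIM('a)) * d ^ DIM('a)" for x :: 'a
    using content_ball[of d x] d(1) by simp
  define m where "m = unit_ball_vol (real DIM('a)) * d ^ DIM('a)"
  have m: "m > 0" using d(1) by (simp add: m_def)
  have "e / 2 * m > 0" using e m by simp
  then obtain n where n: "(LINT x|lborel. tail n x) < e / 2 * m"
    using order_tendstoD(2)[OF lim, of "e / 2 * m"] by (auto simp: eventually_sequentially)
  have "\<bar>f x\<bar> < e" if x: "norm x \<ge> real n + d" for x
  proof (rule ccontr)
    assume "\<not> ?thesis"
    then have fx: "\<bar>f x\<bar> \<ge> e" by simp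
    have "e / 2 * m = (LINT y|lborel. e / 2 * indicator (ball x d) y)"
      using vol[of x] emeasure_lborel_ball_finite[of x d] by (simp add: m_def)
    also have "\<dots> \<le> (LINT y|lborel. tail n y)"
    proof (rule integral_mono)
      show "integrable lborel (\<lambda>y. e / 2 * indicator (ball x d) y :: real)"
        using emeasure_lborel_ball_finite[of x d] by simp
      show "integrable lborel (tail n)" by (rule tail_int)
      fix y
      show "e / 2 * indicator (ball x d) y \<le> tail n y"
      proof (cases "y \<in> ball x d")
        case True
        then have "dist y x < d" by (simp add: dist_commute)
        then have "dist (f y) (f x) < e / 2" "norm (y - x) < d"
          using d(2) by (auto simp: dist_norm)
        then have "\<bar>f y\<bar> \<ge> e / 2" "norm y \<ge> real n"
          using fx x norm_triangle_ineq2[of x y] abs_triangle_ineq2[of "f x" "f y"]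
          by (auto simp: dist_real_def norm_minus_commute abs_minus_commute)
        then show ?thesis using True by (simp add: tail_def)
      qed (simp add: tail_def)
    qed
    finally show False using n by simp
  qed
  then show "\<forall>\<^sub>F x in at_infinity. dist (f x) 0 < e"
    unfolding eventually_at_infinity by auto
qed

section \<open>The Gaussian and its Fourier transform\<close>

definition gauss :: "'a::euclidean_space \<Rightarrow> real" where
  "gauss y = exp (- (norm y)\<^sup>2 / 2)"

lemma gauss_pos: "gauss y > 0"
  by (simp add: gauss_def)

lemma gauss_measurable [measurable]: "gauss \<in> borel_measurable borel"
  unfolding gauss_def by measurable

text \<open>
  The characteristic function of the standard normal distribution, without the normalisation.
\<close>

lemma has_bochner_integral_gauss_real:
  "has_bochner_integral lborel (\<lambda>t. complex_of_real (exp (- t\<^sup>2 / 2)) * iexp (t * s))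
     (complex_of_real (sqrt (2 * pi) * exp (- s\<^sup>2 / 2)))"
proof -
  have 1: "integrable lborel (\<lambda>t. std_normal_density t *\<^sub>R iexp (s * t))"
    by (rule Bochner_Integration.integrable_bound[OF integrable_normal_density[of 1 0]]) auto
  have "(LINT t|lborel. std_normal_density t *\<^sub>R iexp (s * t)) = exp (- s\<^sup>2 / 2)"
    using fun_cong[OF char_std_normal_distribution, of s]
    unfolding char_def by (subst (asm) integral_density) auto
  with 1 have "has_bochner_integral lborel (\<lambda>t. std_normal_density t *\<^sub>R iexp (s * t)) (exp (- s\<^sup>2 / 2))"
    by (simp add: has_bochner_integral_iff)
  from has_bochner_integral_mult_right[OF this, of "complex_of_real (sqrt (2 * pi))"]
  have "has_bochner_integral lborel (\<lambda>t. sqrt (2 * pi) * (std_normal_density t *\<^sub>R iexp (s * t)))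
    (sqrt (2 * pi) * exp (- s\<^sup>2 / 2))" by simp
  moreover have "sqrt (2 * pi) * (std_normal_density t *\<^sub>R iexp (s * t)) =
     complex_of_real (exp (- t\<^sup>2 / 2)) * iexp (t * s)" for t
    by (simp add: std_normal_density_def scaleR_conv_of_real mult.commute exp_of_real[symmetric])
  ultimately show ?thesis by simp
qed

text \<open>
  Both the Gaussian and the complex exponential factor over the coordinates, which reduces the claim
  to dimension one.
\<close>

lemma fourier_gauss:
  fixes y :: "'a::euclidean_space"
  shows "has_bochner_integral lborel (\<lambda>\<xi>. gauss \<xi> * cos (\<xi> \<bullet> y)) (sqrt (2 * pi) ^ DIM('a) * gauss y)"
proof -
  have G: "gauss v = (\<Prod>b\<in>Basis. exp (- (v \<bullet> b)\<^sup>2 / 2))" for v :: 'a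
    unfolding gauss_def power2_norm_eq_inner
    by (subst euclidean_inner) (simp add: exp_sum[symmetric] sum_negf sum_divide_distrib power2_eq_square)
  have "iexp (\<xi> \<bullet> y) = (\<Prod>b\<in>Basis. iexp ((\<xi> \<bullet> b) * (y \<bullet> b)))" for \<xi>
    by (subst euclidean_inner) (simp add: exp_sum[symmetric] sum_distrib_left)
  then have 1: "(\<Prod>b\<in>Basis. complex_of_real (exp (- (\<xi> \<bullet> b)\<^sup>2 / 2)) * iexp ((\<xi> \<bullet> b) * (y \<bullet> b)))
    = complex_of_real (gauss \<xi>) * iexp (\<xi> \<bullet> y)" for \<xi>
    by (simp add: G prod.distrib)
  have 2: "(\<Prod>b\<in>Basis. LINT t|lborel. complex_of_real (exp (- t\<^sup>2 / 2)) * iexp (t * (y \<bullet> b)))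
    = complex_of_real (sqrt (2 * pi) ^ DIM('a) * gauss y)"
    using has_bochner_integral_gauss_real unfolding has_bochner_integral_iff
    by (simp add: G prod.distrib)
  have "has_bochner_integral lborel (\<lambda>\<xi>. complex_of_real (gauss \<xi>) * iexp (\<xi> \<bullet> y))
      (complex_of_real (sqrt (2 * pi) ^ DIM('a) * gauss y))"
    unfolding 1[symmetric] 2[symmetric]
    by (rule has_bochner_integral_lborel_prod)
       (use has_bochner_integral_gauss_real in \<open>simp add: has_bochner_integral_iff\<close>)
  from has_bochner_integral_bounded_linear[OF bounded_linear_Re this]
  show ?thesis by (simp add: Re_exp)
qed

lemma integrable_gauss: "integrable lborel (gauss :: 'a::euclidean_space \<Rightarrow> real)"
  using fourier_gauss[of "0 :: 'a"] by (simp add: has_bochner_integral_iff)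

section \<open>Quadratic forms and the Fourier transform\<close>

lemma Re_fourier_transform:
  assumes \<Phi>: "integrable lborel \<Phi>"
  shows "Re (fourier_transform \<Phi> \<xi>) = (LINT x|lborel. \<Phi> x * cos (\<xi> \<bullet> x))"
proof -
  have [measurable]: "\<Phi> \<in> borel_measurable borel"
    using borel_measurable_integrable[OF \<Phi>] by simp
  have "integrable lborel (\<lambda>x. complex_of_real (\<Phi> x) * exp (- (\<i> * complex_of_real (\<xi> \<bullet> x))))"
    by (rule Bochner_Integration.integrable_bound[OF \<Phi>]) (auto simp: norm_mult norm_exp_eq_Re)
  from integral_bounded_linear[OF bounded_linear_Re this]
  show ?thesis unfolding fourier_transform_def by (simp add: Re_exp)
qed

lemma gauss_le_1: "gauss y \<le> 1"
  by (simp add: gauss_def)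

text \<open>
  Inserting the definition of the Fourier transform and exchanging the integrals leaves the Fourier
  transform of the Gaussian, which is again a Gaussian. The two translates come from
  \<open>2 cos A cos B = cos (A - B) + cos (A + B)\<close>.
\<close>

lemma gauss_fourier_pairing:
  fixes \<Phi> :: "'a::euclidean_space \<Rightarrow> real"
  assumes \<Phi>: "integrable lborel \<Phi>"
  shows "integrable lborel (\<lambda>\<xi>. gauss \<xi> * cos (\<xi> \<bullet> y) * Re (fourier_transform \<Phi> \<xi>))" (is ?int)
    and "integrable lborel (\<lambda>x. gauss x * \<Phi> (x + y))" (is ?int2)
    and "(LINT \<xi>|lborel. gauss \<xi> * cos (\<xi> \<bullet> y) * Re (fourier_transform \<Phi> \<xi>)) =
      sqrt (2 * pi) ^ DIM('a) *
      (((LINT x|lborel. gauss x * \<Phi> (x + y)) + (LINT x|lborel. gauss x * \<Phi> (x - y))) / 2)" (is ?eq)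
proof -
  define N where "N = sqrt (2 * pi) ^ DIM('a)"
  have \<Phi>m [measurable]: "\<Phi> \<in> borel_measurable borel"
    using borel_measurable_integrable[OF \<Phi>] by simp
  have *: "integrable lborel (\<lambda>x. gauss (x + v) * \<Phi> x)" for v
    by (rule Bochner_Integration.integrable_bound[OF \<Phi>])
       (auto simp: abs_mult abs_of_pos gauss_pos intro!: mult_left_le_one_le less_imp_le[OF gauss_pos] gauss_le_1)
  have shift: "has_bochner_integral lborel (\<lambda>x. gauss x * \<Phi> (x - v)) (LINT x|lborel. gauss (x + v) * \<Phi> x)" for v
    using has_bochner_integral_lborel_translate[OF has_bochner_integral_integrable[OF *[of v]], of "- v"]
    by simp
  show ?int2 using shift[of "- y"] by (simp add: has_bochner_integral_iff)
  define h where "h \<xi> x = gauss \<xi> * cos (\<xi> \<bullet> y) * (\<Phi> x * cos (\<xi> \<bullet> x))" for \<xi> x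
  have hm [measurable]: "case_prod h \<in> borel_measurable (borel \<Otimes>\<^sub>M borel)"
    unfolding h_def by measurable
  \<comment> \<open>The oscillating factors of \<open>h\<close> are bounded by \<open>1\<close>, so this tensor product dominates \<open>h\<close>.\<close>
  have "integrable (lborel \<Otimes>\<^sub>M lborel) (\<lambda>(\<xi>::'a, x). gauss \<xi> * \<Phi> x)"
  proof (rule lborel_pair.Fubini_integrable)
    have "integrable lborel (\<lambda>\<xi>::'a. gauss \<xi> * (LINT x|lborel. \<bar>\<Phi> x\<bar>))"
      by (intro integrable_mult_left integrable_gauss)
    then show "integrable lborel (\<lambda>\<xi>::'a. LINT x|lborel. norm (case (\<xi>, x) of (\<xi>, x) \<Rightarrow> gauss \<xi> * \<Phi> x))"
      by (simp add: abs_mult abs_of_pos gauss_pos)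
    show "AE \<xi>::'a in lborel. integrable lborel (\<lambda>x. case (\<xi>, x) of (\<xi>, x) \<Rightarrow> gauss \<xi> * \<Phi> x)"
      using \<Phi> by simp
  qed measurable
  then have hint: "integrable (lborel \<Otimes>\<^sub>M lborel) (case_prod h)"
  proof (rule Bochner_Integration.integrable_bound)
    have "\<bar>h \<xi> x\<bar> \<le> \<bar>gauss \<xi> * \<Phi> x\<bar>" for \<xi> x
    proof -
      have "\<bar>h \<xi> x\<bar> = \<bar>gauss \<xi> * \<Phi> x\<bar> * (\<bar>cos (\<xi> \<bullet> y)\<bar> * \<bar>cos (\<xi> \<bullet> x)\<bar>)"
        by (simp add: h_def abs_mult)
      also have "\<dots> \<le> \<bar>gauss \<xi> * \<Phi> x\<bar> * (1 * 1)"
        by (intro mult_left_mono mult_mono) auto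
      finally show ?thesis by simp
    qed
    then show "AE p in lborel \<Otimes>\<^sub>M lborel. norm (case_prod h p) \<le> norm (case p of (\<xi>, x) \<Rightarrow> gauss \<xi> * \<Phi> x)"
      by auto
  qed simp
  have inner: "(LINT x|lborel. h \<xi> x) = gauss \<xi> * cos (\<xi> \<bullet> y) * Re (fourier_transform \<Phi> \<xi>)" for \<xi>
    by (simp add: h_def Re_fourier_transform[OF \<Phi>])
  show ?int
    using lborel_pair.integrable_fst[OF hint] by (simp add: inner)
  have outer: "(LINT \<xi>|lborel. h \<xi> x) = N * ((gauss (x - y) * \<Phi> x + gauss (x + y) * \<Phi> x) / 2)" for x
  proof -
    have "(\<lambda>\<xi>. h \<xi> x) = (\<lambda>\<xi>. \<Phi> x / 2 * (gauss \<xi> * cos (\<xi> \<bullet> (x - y)) + gauss \<xi> * cos (\<xi> \<bullet> (x + y))))"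
      by (simp add: h_def cos_add cos_diff inner_add_right inner_diff_right algebra_simps)
    moreover have "has_bochner_integral lborel
        (\<lambda>\<xi>. \<Phi> x / 2 * (gauss \<xi> * cos (\<xi> \<bullet> (x - y)) + gauss \<xi> * cos (\<xi> \<bullet> (x + y))))
        (\<Phi> x / 2 * (N * gauss (x - y) + N * gauss (x + y)))"
      unfolding N_def
      by (intro has_bochner_integral_mult_right has_bochner_integral_add fourier_gauss)
    ultimately show ?thesis
      by (simp add: has_bochner_integral_iff algebra_simps add_divide_distrib)
  qed
  have "(LINT \<xi>|lborel. gauss \<xi> * cos (\<xi> \<bullet> y) * Re (fourier_transform \<Phi> \<xi>)) = (LINT x|lborel. LINT \<xi>|lborel. h \<xi> x)"
    unfolding inner[symmetric] by (rule lborel_pair.Fubini_integral[symmetric, OF hint])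
  also have "\<dots> = N * (((LINT x|lborel. gauss (x + (- y)) * \<Phi> x) + (LINT x|lborel. gauss (x + y) * \<Phi> x)) / 2)"
    unfolding outer using *[of y] *[of "- y"] by simp
  also have "\<dots> = N * (((LINT x|lborel. gauss x * \<Phi> (x + y)) + (LINT x|lborel. gauss x * \<Phi> (x - y))) / 2)"
    using shift[of y] shift[of "- y"] by (simp add: has_bochner_integral_iff)
  finally show ?eq by (simp add: N_def)
qed

lemma cmod_exponential_sum_squared:
  fixes z :: "'i \<Rightarrow> 'a::real_inner" and a :: "'i \<Rightarrow> real"
  shows "(cmod (\<Sum>i\<in>I. complex_of_real (a i) * cis (\<xi> \<bullet> z i)))\<^sup>2
    = (\<Sum>i\<in>I. \<Sum>j\<in>I. a i * a j * cos (\<xi> \<bullet> (z i - z j)))"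
proof -
  have "(cmod (\<Sum>i\<in>I. complex_of_real (a i) * cis (\<xi> \<bullet> z i)))\<^sup>2
     = (\<Sum>i\<in>I. a i * cos (\<xi> \<bullet> z i))\<^sup>2 + (\<Sum>i\<in>I. a i * sin (\<xi> \<bullet> z i))\<^sup>2"
    by (simp add: cmod_power2)
  also have "\<dots> = (\<Sum>i\<in>I. \<Sum>j\<in>I. a i * a j * cos (\<xi> \<bullet> (z i - z j)))"
    unfolding power2_eq_square sum_product sum.distrib[symmetric]
    by (intro sum.cong refl) (simp add: inner_diff_right cos_diff algebra_simps)
  finally show ?thesis .
qed

text \<open>
  Expanding \<open>P = |p|\<^sup>2\<close> into cosines and pairing each with the Gaussian turns the integral into a multiple
  of \<open>\<integral> g F\<close>, where \<open>F(x) = \<Sum> a\<^sub>i a\<^sub>j \<Phi>(x + z\<^sub>i - z\<^sub>j)\<close>. Now \<open>F \<le> F(0)\<close>, and \<open>F(0)\<close> is the quadratic form.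
  Each of the two Gaussian integrals involved contributes a factor \<open>(2\<pi>)\<^bsup>d/2\<^esup>\<close>.
\<close>

lemma fourier_energy_le_quadratic_form:
  fixes \<Phi> :: "'a::euclidean_space \<Rightarrow> real" and z :: "'i \<Rightarrow> 'a" and a :: "'i \<Rightarrow> real"
  assumes K: "positive_definite_kernel (\<lambda>u v. \<Phi> (u - v))" and \<Phi>: "integrable lborel \<Phi>" and I: "finite I"
  defines "P \<equiv> \<lambda>\<xi>. (cmod (\<Sum>i\<in>I. complex_of_real (a i) * cis (\<xi> \<bullet> z i)))\<^sup>2"
  shows "integrable lborel (\<lambda>\<xi>. gauss \<xi> * P \<xi> * Re (fourier_transform \<Phi> \<xi>))"
    and "(LINT \<xi>|lborel. gauss \<xi> * P \<xi> * Re (fourier_transform \<Phi> \<xi>))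
      \<le> (2 * pi) ^ DIM('a) * (\<Sum>i\<in>I. \<Sum>j\<in>I. a i * a j * \<Phi> (z i - z j))"
proof -
  define N where "N = sqrt (2 * pi) ^ DIM('a)"
  let ?w = "\<lambda>i j \<xi>. gauss \<xi> * cos (\<xi> \<bullet> (z i - z j)) * Re (fourier_transform \<Phi> \<xi>)"
  let ?g = "\<lambda>y. LINT x|lborel. gauss x * \<Phi> (x + y)"
  define F where "F x = (\<Sum>i\<in>I. \<Sum>j\<in>I. a i * a j * \<Phi> (x + z i - z j))" for x
  have N0: "N > 0" by (simp add: N_def)
  have P: "(\<lambda>\<xi>. gauss \<xi> * P \<xi> * Re (fourier_transform \<Phi> \<xi>)) = (\<lambda>\<xi>. \<Sum>i\<in>I. \<Sum>j\<in>I. a i * a j * ?w i j \<xi>)"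
    unfolding P_def cmod_exponential_sum_squared
    by (simp add: sum_distrib_left sum_distrib_right mult_ac)
  have int: "integrable lborel (\<lambda>\<xi>. \<Sum>i\<in>I. \<Sum>j\<in>I. a i * a j * ?w i j \<xi>)"
    by (intro Bochner_Integration.integrable_sum integrable_mult_right gauss_fourier_pairing \<Phi>)
  then show "integrable lborel (\<lambda>\<xi>. gauss \<xi> * P \<xi> * Re (fourier_transform \<Phi> \<xi>))"
    by (simp only: P)
  have Fint: "integrable lborel (\<lambda>x. gauss x * \<Phi> (x + z i - z j))" for i j
    using gauss_fourier_pairing(2)[OF \<Phi>, of "z i - z j"] by (simp add: add_diff_eq)
  have GF: "(\<lambda>x. gauss x * F x) = (\<lambda>x. \<Sum>i\<in>I. \<Sum>j\<in>I. a i * a j * (gauss x * \<Phi> (x + z i - z j)))"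
    by (simp add: F_def sum_distrib_left mult_ac)
  have GFint: "integrable lborel (\<lambda>x. gauss x * F x)"
    unfolding GF by (intro Bochner_Integration.integrable_sum integrable_mult_right Fint)
  have "(LINT \<xi>|lborel. gauss \<xi> * P \<xi> * Re (fourier_transform \<Phi> \<xi>))
      = (\<Sum>i\<in>I. \<Sum>j\<in>I. a i * a j * (LINT \<xi>|lborel. ?w i j \<xi>))"
    unfolding P
    by (subst Bochner_Integration.integral_sum, (intro Bochner_Integration.integrable_sum integrable_mult_right gauss_fourier_pairing \<Phi>),
        subst Bochner_Integration.integral_sum, (intro integrable_mult_right gauss_fourier_pairing \<Phi>)) simp
  also have "\<dots> = (\<Sum>i\<in>I. \<Sum>j\<in>I. N / 2 * (a i * a j * ?g (z i - z j)) + N / 2 * (a i * a j * ?g (z j - z i)))"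
  proof (intro sum.cong refl)
    fix i j
    have "(LINT \<xi>|lborel. ?w i j \<xi>) = N * ((?g (z i - z j) + ?g (z j - z i)) / 2)"
      unfolding gauss_fourier_pairing(3)[OF \<Phi>] N_def by (simp add: algebra_simps)
    then show "a i * a j * (LINT \<xi>|lborel. ?w i j \<xi>)
      = N / 2 * (a i * a j * ?g (z i - z j)) + N / 2 * (a i * a j * ?g (z j - z i))"
      by (simp only:) (simp only: distrib_left add_divide_distrib times_divide_eq_left times_divide_eq_right mult_ac)
  qed
  also have "\<dots> = N / 2 * (\<Sum>i\<in>I. \<Sum>j\<in>I. a i * a j * ?g (z i - z j))
      + N / 2 * (\<Sum>i\<in>I. \<Sum>j\<in>I. a i * a j * ?g (z j - z i))"
    by (simp add: sum.distrib sum_distrib_left)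
  also have "(\<Sum>i\<in>I. \<Sum>j\<in>I. a i * a j * ?g (z j - z i)) = (\<Sum>i\<in>I. \<Sum>j\<in>I. a i * a j * ?g (z i - z j))"
    by (subst sum.swap) (simp add: mult.commute)
  also have "N / 2 * (\<Sum>i\<in>I. \<Sum>j\<in>I. a i * a j * ?g (z i - z j))
      + N / 2 * (\<Sum>i\<in>I. \<Sum>j\<in>I. a i * a j * ?g (z i - z j))
      = N * (\<Sum>i\<in>I. \<Sum>j\<in>I. a i * a j * ?g (z i - z j))" by simp
  also have "(\<Sum>i\<in>I. \<Sum>j\<in>I. a i * a j * ?g (z i - z j)) = (LINT x|lborel. gauss x * F x)"
    unfolding GF
    by (subst Bochner_Integration.integral_sum, (intro Bochner_Integration.integrable_sum integrable_mult_right Fint),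
        subst Bochner_Integration.integral_sum, (intro integrable_mult_right Fint)) (simp add: add_diff_eq)
  also have "(LINT x|lborel. gauss x * F x) \<le> (LINT x::'a|lborel. gauss x * F 0)"
  proof (rule integral_mono[OF GFint])
    show "integrable lborel (\<lambda>x::'a. gauss x * F 0)" by (intro integrable_mult_left integrable_gauss)
    fix x :: 'a
    have "F x \<le> F 0"
      using positive_definite_shifted_sum_bound[OF K I, of a x z] unfolding F_def by simp
    then show "gauss x * F x \<le> gauss x * F 0"
      by (intro mult_left_mono less_imp_le[OF gauss_pos])
  qed
  also have "(LINT x::'a|lborel. gauss x * F 0) = N * F 0"
    using fourier_gauss[of "0::'a"] by (simp add: has_bochner_integral_iff N_def gauss_def)
  also have "N * (N * F 0) = (2 * pi) ^ DIM('a) * F 0"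
    unfolding mult.assoc[symmetric] unfolding N_def power_mult_distrib[symmetric] by simp
  finally show "(LINT \<xi>|lborel. gauss \<xi> * P \<xi> * Re (fourier_transform \<Phi> \<xi>))
      \<le> (2 * pi) ^ DIM('a) * (\<Sum>i\<in>I. \<Sum>j\<in>I. a i * a j * \<Phi> (z i - z j))"
    using N0 by (simp add: F_def)
qed

text \<open>
  The constant \<open>B\<close> is uniform in the points, so the bound survives when they are pulled together and
  the quadratic form degenerates.
  The weight \<open>w\<close> is a radially decreasing minorant of \<open>g \<Phi>^\<close>. Since it decreases,
  \<open>w(n\<xi>) \<le> w(k\<xi>)\<close> for \<open>k \<le> n\<close>, so each sample \<open>|p(k\<xi>)|\<^sup>2\<close> in the Turan-type inequality can be paired
  with the weight at the same point, and rescaling \<open>\<xi>\<close> makes all these integrals comparable to that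
  of \<open>w |p|\<^sup>2\<close>.
\<close>

lemma sum_squared_le_quadratic_form:
  fixes \<Phi> :: "'a::euclidean_space \<Rightarrow> real" and I :: "'i set"
  assumes K: "positive_definite_kernel (\<lambda>u v. \<Phi> (u - v))" and \<Phi>: "integrable lborel \<Phi>"
    and I: "finite I" "I \<noteq> {}"
    and C: "C > 0" "\<alpha> \<ge> 0"
    and lower: "\<And>\<xi>. C * (1 + (norm \<xi>)\<^sup>2) powr (- \<alpha>) \<le> Re (fourier_transform \<Phi> \<xi>)"
  obtains B where "B > 0"
    and "\<And>(z :: 'i \<Rightarrow> 'a) a. (\<Sum>i\<in>I. a i)\<^sup>2 \<le> B * (\<Sum>i\<in>I. \<Sum>j\<in>I. a i * a j * \<Phi> (z i - z j))"
proof -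
  define n where "n = card I"
  have n: "n \<ge> 1" using I by (simp add: n_def Suc_le_eq card_gt_0_iff)
  define w where "w \<xi> = gauss \<xi> * (C * (1 + (norm \<xi>)\<^sup>2) powr (- \<alpha>))" for \<xi> :: 'a
  have wm [measurable]: "w \<in> borel_measurable borel" unfolding w_def by measurable
  have base: "1 + (norm \<xi>)\<^sup>2 > 0" for \<xi> :: 'a by (simp add: add_pos_nonneg)
  have w_pos: "w \<xi> > 0" for \<xi>
    using C base[of \<xi>] unfolding w_def by (intro mult_pos_pos gauss_pos) simp_all
  have w_decreasing: "w \<xi> \<le> w \<eta>" if "norm \<eta> \<le> norm \<xi>" for \<xi> \<eta>
  proof -
    have le: "(norm \<eta>)\<^sup>2 \<le> (norm \<xi>)\<^sup>2" using that by (intro power_mono) auto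
    have "(1 + (norm \<xi>)\<^sup>2) powr (- \<alpha>) \<le> (1 + (norm \<eta>)\<^sup>2) powr (- \<alpha>)"
      using C base le by (intro powr_mono2') auto
    moreover have "gauss \<xi> \<le> gauss \<eta>" using le by (simp add: gauss_def)
    ultimately show ?thesis
      unfolding w_def using C gauss_pos[of \<eta>] by (intro mult_mono mult_left_mono) auto
  qed
  have w_int: "integrable lborel w"
  proof (rule Bochner_Integration.integrable_bound)
    show "integrable lborel (\<lambda>\<xi>::'a. C * gauss \<xi>)" by (intro integrable_mult_right integrable_gauss)
    have "(1 + (norm \<xi>)\<^sup>2) powr (- \<alpha>) \<le> 1" for \<xi> :: 'a
      using powr_mono2'[of "- \<alpha>" 1 "1 + (norm \<xi>)\<^sup>2"] C(2) by simp
    then have "gauss \<xi> * (C * (1 + (norm \<xi>)\<^sup>2) powr (- \<alpha>)) \<le> gauss \<xi> * (C * 1)" for \<xi> :: 'a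
      using C(1) by (intro mult_left_mono less_imp_le[OF gauss_pos]) auto
    then have "w \<xi> \<le> C * gauss \<xi>" for \<xi>
      by (simp add: w_def mult.commute)
    then show "AE \<xi> in lborel. norm (w \<xi>) \<le> norm (C * gauss \<xi>)"
      by (intro AE_I2) (simp add: abs_mult abs_of_pos w_pos gauss_pos C(1))
  qed simp
  have scaled_int: "integrable lborel (\<lambda>\<xi>. w (real n *\<^sub>R \<xi>))"
    using has_bochner_integral_lborel_scale[OF has_bochner_integral_integrable[OF w_int], of n] n
    by (simp add: has_bochner_integral_iff)
  define c0 where "c0 = (LINT \<xi>|lborel. w (real n *\<^sub>R \<xi>))"
  have c0: "c0 > 0" unfolding c0_def by (rule lborel_integral_pos[OF scaled_int w_pos])
  define B where "B = 4 ^ n * real n * (2 * pi) ^ DIM('a) / c0"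
  show thesis
  proof
    show "B > 0" using n c0 by (simp add: B_def)
    fix z :: "'i \<Rightarrow> 'a" and a :: "'i \<Rightarrow> real"
    define Q where "Q = (\<Sum>i\<in>I. \<Sum>j\<in>I. a i * a j * \<Phi> (z i - z j))"
    define P where "P \<xi> = (cmod (\<Sum>i\<in>I. complex_of_real (a i) * cis (\<xi> \<bullet> z i)))\<^sup>2" for \<xi>
    have Pm [measurable]: "P \<in> borel_measurable borel"
      unfolding P_def cmod_exponential_sum_squared by measurable
    have P0: "P \<xi> \<ge> 0" for \<xi> by (simp add: P_def)
    note energy = fourier_energy_le_quadratic_form[OF K \<Phi> I(1), of a z, folded P_def Q_def]
    have wP: "w \<xi> * P \<xi> \<le> gauss \<xi> * P \<xi> * Re (fourier_transform \<Phi> \<xi>)" for \<xi>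
      using mult_left_mono[OF lower[of \<xi>], of "gauss \<xi> * P \<xi>"] P0[of \<xi>] gauss_pos[of \<xi>]
      by (simp add: w_def mult_ac)
    have wP_int: "integrable lborel (\<lambda>\<xi>. w \<xi> * P \<xi>)"
      by (rule Bochner_Integration.integrable_bound[OF energy(1)])
         (auto intro!: AE_I2 order_trans[OF _ abs_ge_self] wP simp: abs_of_nonneg P0 w_pos less_imp_le)
    have wP_nonneg: "(LINT \<xi>|lborel. w \<xi> * P \<xi>) \<ge> 0"
      by (intro Bochner_Integration.integral_nonneg mult_nonneg_nonneg less_imp_le[OF w_pos] P0)
    have "(LINT \<xi>|lborel. w \<xi> * P \<xi>) \<le> (LINT \<xi>|lborel. gauss \<xi> * P \<xi> * Re (fourier_transform \<Phi> \<xi>))"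
      by (rule integral_mono[OF wP_int energy(1) wP])
    also have "\<dots> \<le> (2 * pi) ^ DIM('a) * Q" by (rule energy(2))
    finally have total: "(LINT \<xi>|lborel. w \<xi> * P \<xi>) \<le> (2 * pi) ^ DIM('a) * Q" .
    have dilate: "has_bochner_integral lborel (\<lambda>\<xi>. w (real k *\<^sub>R \<xi>) * P (real k *\<^sub>R \<xi>))
        ((LINT \<xi>|lborel. w \<xi> * P \<xi>) / real k ^ DIM('a))" if "k \<ge> 1" for k
      using has_bochner_integral_lborel_scale[OF has_bochner_integral_integrable[OF wP_int], of "real k"] that
      by simp
    have "(\<Sum>i\<in>I. a i)\<^sup>2 * c0 = (LINT \<xi>|lborel. (\<Sum>i\<in>I. a i)\<^sup>2 * w (real n *\<^sub>R \<xi>))"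
      by (simp add: c0_def)
    also have "\<dots> \<le> (LINT \<xi>|lborel. 4 ^ n * (\<Sum>k=1..n. w (real k *\<^sub>R \<xi>) * P (real k *\<^sub>R \<xi>)))"
    proof (rule integral_mono)
      show "integrable lborel (\<lambda>\<xi>. (\<Sum>i\<in>I. a i)\<^sup>2 * w (real n *\<^sub>R \<xi>))"
        by (intro integrable_mult_right scaled_int)
      show "integrable lborel (\<lambda>\<xi>. 4 ^ n * (\<Sum>k=1..n. w (real k *\<^sub>R \<xi>) * P (real k *\<^sub>R \<xi>)))"
        using dilate by (intro integrable_mult_right Bochner_Integration.integrable_sum)
          (auto simp: has_bochner_integral_iff)
      fix \<xi>
      have Pk: "P (real k *\<^sub>R \<xi>) = (cmod (\<Sum>i\<in>I. complex_of_real (a i) * cis (\<xi> \<bullet> z i) ^ k))\<^sup>2" for k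
        by (simp add: P_def Complex.DeMoivre)
      have "(\<Sum>i\<in>I. a i)\<^sup>2 \<le> 4 ^ n * (\<Sum>k=1..n. P (real k *\<^sub>R \<xi>))"
        using turan_power_sum[OF I(1), of "\<lambda>i. cis (\<xi> \<bullet> z i)" "\<lambda>i. complex_of_real (a i)"]
        unfolding Pk n_def of_real_sum[symmetric] norm_of_real by simp
      then have "(\<Sum>i\<in>I. a i)\<^sup>2 * w (real n *\<^sub>R \<xi>) \<le> 4 ^ n * (\<Sum>k=1..n. P (real k *\<^sub>R \<xi>)) * w (real n *\<^sub>R \<xi>)"
        by (intro mult_right_mono less_imp_le[OF w_pos])
      also have "\<dots> = 4 ^ n * (\<Sum>k=1..n. w (real n *\<^sub>R \<xi>) * P (real k *\<^sub>R \<xi>))"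
        by (simp add: sum_distrib_left sum_distrib_right mult_ac)
      also have "\<dots> \<le> 4 ^ n * (\<Sum>k=1..n. w (real k *\<^sub>R \<xi>) * P (real k *\<^sub>R \<xi>))"
        by (intro mult_left_mono sum_mono mult_right_mono P0 w_decreasing) (auto intro!: mult_right_mono)
      finally show "(\<Sum>i\<in>I. a i)\<^sup>2 * w (real n *\<^sub>R \<xi>)
          \<le> 4 ^ n * (\<Sum>k=1..n. w (real k *\<^sub>R \<xi>) * P (real k *\<^sub>R \<xi>))" .
    qed
    also have "\<dots> = 4 ^ n * (\<Sum>k=1..n. (LINT \<xi>|lborel. w \<xi> * P \<xi>) / real k ^ DIM('a))"
      using dilate by (subst Bochner_Integration.integral_mult_right, intro Bochner_Integration.integrable_sum) 
       (auto simp: has_bochner_integral_iff)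
    also have "\<dots> \<le> 4 ^ n * (\<Sum>k=1..n. (LINT \<xi>|lborel. w \<xi> * P \<xi>))"
    proof (intro mult_left_mono sum_mono)
      fix k assume "k \<in> {1..n}"
      then have "k \<ge> 1" by simp
      then have "1 \<le> real k ^ DIM('a)" by simp
      with \<open>k \<ge> 1\<close> show "(LINT \<xi>|lborel. w \<xi> * P \<xi>) / real k ^ DIM('a) \<le> (LINT \<xi>|lborel. w \<xi> * P \<xi>)"
        using divide_left_mono[of 1 "real k ^ DIM('a)" "LINT \<xi>|lborel. w \<xi> * P \<xi>"] wP_nonneg by simp
    qed simp
    also have "\<dots> \<le> 4 ^ n * (real n * ((2 * pi) ^ DIM('a) * Q))"
      using mult_left_mono[OF total, of "real n"] by simp
    finally show "(\<Sum>i\<in>I. a i)\<^sup>2 \<le> B * Q"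
      using c0 by (simp add: B_def field_simps)
  qed
qed

section \<open>Positive definite matrices\<close>

lemma tendsto_det:
  fixes A :: "'b \<Rightarrow> real ^ 'n ^ 'n"
  assumes "\<And>i j. ((\<lambda>t. A t $ i $ j) \<longlongrightarrow> L $ i $ j) F"
  shows "((\<lambda>t. det (A t)) \<longlongrightarrow> det L) F"
  unfolding det_def by (intro tendsto_intros assms)

lemma positive_definite_matrix_invertible:
  fixes A :: "real ^ 'n ^ 'n"
  assumes pd: "\<And>v. v \<noteq> 0 \<Longrightarrow> v \<bullet> (A *v v) > 0"
  shows "invertible A"
  unfolding invertible_left_inverse matrix_left_invertible_ker
proof (intro allI impI)
  fix v assume "A *v v = 0"
  then show "v = 0" using pd[of v] by (cases "v = 0") auto
qed

text \<open>
  On the segment from the identity to \<open>A\<close> all matrices are positive definite, hence invertible, so the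
  determinant keeps the sign that it has at the identity.
\<close>

lemma positive_definite_matrix_det_pos:
  fixes A :: "real ^ 'n ^ 'n"
  assumes pd: "\<And>v. v \<noteq> 0 \<Longrightarrow> v \<bullet> (A *v v) > 0"
  shows "det A > 0"
proof (rule ccontr)
  assume neg: "\<not> det A > 0"
  define H where "H t = (1 - t) *\<^sub>R mat 1 + t *\<^sub>R A" for t
  have nz: "det (H t) \<noteq> 0" if t: "0 \<le> t" "t \<le> 1" for t
  proof -
    have "v \<bullet> (H t *v v) > 0" if v: "v \<noteq> 0" for v
    proof -
      have "v \<bullet> (H t *v v) = (1 - t) * (v \<bullet> v) + t * (v \<bullet> (A *v v))"
        by (simp add: H_def matrix_vector_mult_add_rdistrib scaleR_matrix_vector_assoc[symmetric]
            inner_add_right)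
      moreover have "v \<bullet> v > 0" using v by simp
      ultimately show ?thesis using pd[OF v] t
        by (cases "t = 1") (auto intro!: add_pos_nonneg)
    qed
    then show ?thesis
      using positive_definite_matrix_invertible invertible_det_nz by blast
  qed
  have "continuous_on {0..1} (\<lambda>t. det (H t))"
    unfolding continuous_on_def
    by (intro ballI tendsto_det) (auto simp: H_def intro!: tendsto_intros)
  moreover have "det (H 1) \<le> 0" "0 \<le> det (H 0)" using neg by (simp_all add: H_def)
  ultimately obtain t where "0 \<le> t" "t \<le> 1" "det (H t) = 0"
    using IVT2'[of "\<lambda>t. det (H t)" 1 0 0] by auto
  with nz show False by blast
qed

lemma matrix_vector_mult_matrix_inv:
  fixes A :: "real ^ 'n ^ 'n"
  assumes "invertible A"
  shows "A *v (matrix_inv A *v v) = v"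
proof -
  have "A ** matrix_inv A = mat 1"
    using assms unfolding invertible_def matrix_inv_def by (rule someI2_ex) simp
  then show ?thesis by (simp add: matrix_vector_mul_assoc)
qed

lemma positive_definite_matrix_inv_nonneg:
  fixes A :: "real ^ 'n ^ 'n"
  assumes pd: "\<And>v. v \<noteq> 0 \<Longrightarrow> v \<bullet> (A *v v) > 0"
  shows "v \<bullet> (matrix_inv A *v v) \<ge> 0"
proof -
  define u where "u = matrix_inv A *v v"
  have "v = A *v u"
    by (simp add: u_def matrix_vector_mult_matrix_inv[OF positive_definite_matrix_invertible[OF pd]])
  then have "v \<bullet> u = u \<bullet> (A *v u)" by (simp add: inner_commute)
  also have "\<dots> \<ge> 0" using pd[of u] by (cases "u = 0") auto
  finally show ?thesis by (simp add: u_def)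
qed

text \<open>
  The dual form of a lower bound on \<open>A\<close>: apply the hypothesis to the solution \<open>v\<close> of \<open>A v = w\<close> and
  divide by \<open>w \<bullet> v\<close>, which is the left-hand side of the conclusion.
\<close>

lemma inverse_quadratic_form_le:
  fixes A :: "real ^ 'n ^ 'n"
  assumes pd: "\<And>v. v \<noteq> 0 \<Longrightarrow> v \<bullet> (A *v v) > 0"
    and B: "B \<ge> 0" and bound: "\<And>v. (w \<bullet> v)\<^sup>2 \<le> B * (v \<bullet> (A *v v))"
  shows "w \<bullet> (matrix_inv A *v w) \<le> B"
proof -
  define u where "u = matrix_inv A *v w"
  have "A *v u = w"
    by (simp add: u_def matrix_vector_mult_matrix_inv[OF positive_definite_matrix_invertible[OF pd]])
  then have "(w \<bullet> u)\<^sup>2 \<le> B * (w \<bullet> u)" using bound[of u] by (simp add: inner_commute)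
  moreover have "w \<bullet> u \<ge> 0" unfolding u_def by (rule positive_definite_matrix_inv_nonneg[OF pd])
  ultimately show ?thesis unfolding u_def[symmetric] using B
    by (cases "w \<bullet> u = 0") (auto simp: power2_eq_square)
qed

section \<open>Kernel matrices at varying scale\<close>

abbreviation scaled_matrix ::
  "('a::real_vector \<Rightarrow> real) \<Rightarrow> ('n \<Rightarrow> 'a) \<Rightarrow> real \<Rightarrow> real ^ 'n ^ 'n" where
  "scaled_matrix \<Phi> x lam \<equiv> kernel_matrix (scaled_kernel \<Phi> lam) x"

lemma scaled_matrix_entry:
  "scaled_matrix \<Phi> x lam $ i $ j = \<Phi> ((x i - x j) /\<^sub>R lam)"
  by (simp add: kernel_matrix_def scaled_kernel_def)

lemma scaled_matrix_quadratic_form: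
  fixes x :: "'n::finite \<Rightarrow> 'a::real_vector"
  shows "v \<bullet> (scaled_matrix \<Phi> x lam *v v)
    = (\<Sum>i\<in>UNIV. \<Sum>j\<in>UNIV. v $ i * v $ j * \<Phi> (x i /\<^sub>R lam - x j /\<^sub>R lam))"
  by (simp add: inner_vec_def matrix_vector_mult_def scaled_matrix_entry sum_distrib_left
      scaleR_diff_right mult_ac)

lemma scaled_matrix_positive_definite:
  fixes x :: "'n::finite \<Rightarrow> 'a::real_vector"
  assumes K: "positive_definite_kernel (\<lambda>u v. \<Phi> (u - v))" and x: "inj x" and lam: "lam > 0"
    and v: "v \<noteq> 0"
  shows "v \<bullet> (scaled_matrix \<Phi> x lam *v v) > 0"
  unfolding scaled_matrix_quadratic_form
proof (rule positive_definite_kernel_sum_pos[OF K])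
  show "inj (\<lambda>i. x i /\<^sub>R lam)" using x lam by (auto simp: inj_on_def)
  show "\<exists>i\<in>UNIV. v $ i \<noteq> 0" using v by (auto simp: vec_eq_iff)
qed simp

text \<open>
  All entries tend to \<open>\<Phi> 0\<close>, and a matrix with two equal rows is singular.
\<close>

lemma det_scaled_matrix_at_top:
  fixes x :: "'n::finite \<Rightarrow> 'a::real_normed_vector"
  assumes cont: "isCont \<Phi> 0" and n: "CARD('n) \<ge> 2"
  shows "((\<lambda>lam. det (scaled_matrix \<Phi> x lam)) \<longlongrightarrow> 0) at_top"
proof -
  define J :: "real ^ 'n ^ 'n" where "J = (\<chi> i j. \<Phi> 0)"
  have "((\<lambda>lam. det (scaled_matrix \<Phi> x lam)) \<longlongrightarrow> det J) at_top"
  proof (rule tendsto_det)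
    fix i j
    have "((\<lambda>lam. inverse lam *\<^sub>R (x i - x j)) \<longlongrightarrow> 0 *\<^sub>R (x i - x j)) at_top"
      by (intro tendsto_intros tendsto_inverse_0_at_top filterlim_ident)
    then have "((\<lambda>lam. (x i - x j) /\<^sub>R lam) \<longlongrightarrow> 0) at_top" by simp
    from isCont_tendsto_compose[OF cont this]
    show "((\<lambda>lam. scaled_matrix \<Phi> x lam $ i $ j) \<longlongrightarrow> J $ i $ j) at_top"
      by (simp add: scaled_matrix_entry J_def)
  qed
  moreover have "det J = 0"
  proof -
    obtain i j :: 'n where "i \<noteq> j"
      using n card_le_Suc0_iff_eq[of "UNIV :: 'n set"] by auto
    then show ?thesis by (rule det_identical_rows) (simp add: row_def J_def)
  qed
  ultimately show ?thesis by simp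
qed

text \<open>
  Distinct points move apart without bound as the scale shrinks, so the matrix becomes diagonal in the
  limit.
\<close>

lemma det_scaled_matrix_at_right_0:
  fixes x :: "'n::finite \<Rightarrow> 'a::real_normed_vector"
  assumes vanish: "(\<Phi> \<longlongrightarrow> 0) at_infinity" and x: "inj x"
  shows "((\<lambda>lam. det (scaled_matrix \<Phi> x lam)) \<longlongrightarrow> \<Phi> 0 ^ CARD('n)) (at_right 0)"
proof -
  define D :: "real ^ 'n ^ 'n" where "D = (\<chi> i j. if i = j then \<Phi> 0 else 0)"
  have "((\<lambda>lam. det (scaled_matrix \<Phi> x lam)) \<longlongrightarrow> det D) (at_right 0)"
  proof (rule tendsto_det)
    fix i j
    show "((\<lambda>lam. scaled_matrix \<Phi> x lam $ i $ j) \<longlongrightarrow> D $ i $ j) (at_right 0)"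
    proof (cases "i = j")
      case False
      then have nz: "norm (x i - x j) > 0" using x by (auto dest: injD)
      have "filterlim (\<lambda>lam. norm (x i - x j) * inverse lam) at_top (at_right 0)"
        by (rule filterlim_tendsto_pos_mult_at_top[OF tendsto_const nz filterlim_inverse_at_top_right])
      moreover have "\<forall>\<^sub>F lam in at_right 0. norm (x i - x j) * inverse lam = norm ((x i - x j) /\<^sub>R lam)"
        using eventually_at_right_less[of 0] by eventually_elim (simp add: divide_inverse mult.commute)
      ultimately have "filterlim (\<lambda>lam. norm ((x i - x j) /\<^sub>R lam)) at_top (at_right 0)"
        by (simp only: filterlim_cong[OF refl refl])
      then have "filterlim (\<lambda>lam. (x i - x j) /\<^sub>R lam) at_infinity (at_right 0)"
        by (rule filterlim_norm_at_top_imp_at_infinity)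
      from filterlim_compose[OF vanish this] show ?thesis
        using False by (simp add: scaled_matrix_entry D_def)
    qed (simp add: scaled_matrix_entry D_def)
  qed
  moreover have "det D = \<Phi> 0 ^ CARD('n)"
    by (subst det_diagonal) (simp_all add: D_def)
  ultimately show ?thesis by simp
qed

text \<open>
  Near \<open>0\<close> the limit of the determinant provides the bound; on the remaining compact interval the
  determinant attains its minimum.
\<close>

lemma det_scaled_matrix_bounded_below:
  fixes x :: "'n::finite \<Rightarrow> 'a::real_normed_vector"
  assumes K: "positive_definite_kernel (\<lambda>u v. \<Phi> (u - v))" and cont: "continuous_on UNIV \<Phi>"
    and vanish: "(\<Phi> \<longlongrightarrow> 0) at_infinity" and x: "inj x" and M: "M > 0"
  shows "\<exists>m>0. \<forall>lam\<in>{0<..M}. m \<le> det (scaled_matrix \<Phi> x lam)"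
proof -
  define D where "D lam = det (scaled_matrix \<Phi> x lam)" for lam
  have D_pos: "D lam > 0" if "lam > 0" for lam
    unfolding D_def
    by (rule positive_definite_matrix_det_pos) (rule scaled_matrix_positive_definite[OF K x that])
  define m0 where "m0 = \<Phi> 0 ^ CARD('n) / 2"
  have m0: "m0 > 0" "m0 < \<Phi> 0 ^ CARD('n)"
    using positive_definite_kernel_at_0[OF K] by (auto simp: m0_def)
  have "\<forall>\<^sub>F lam in at_right 0. m0 < D lam"
    unfolding D_def by (rule order_tendstoD(1)[OF det_scaled_matrix_at_right_0[OF vanish x] m0(2)])
  then obtain b where b: "b > 0" "\<And>lam. 0 < lam \<Longrightarrow> lam < b \<Longrightarrow> m0 < D lam"
    unfolding eventually_at_right_field by auto
  define b' where "b' = min b M"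
  have b': "0 < b'" "b' \<le> b" "b' \<le> M" using b(1) M by (auto simp: b'_def)
  have "continuous_on {b'..M} D"
    unfolding D_def continuous_on_def
  proof (intro ballI tendsto_det)
    fix lam i j assume "lam \<in> {b'..M}"
    then have "lam \<noteq> 0" using b'(1) by auto
    then have "((\<lambda>t. (x i - x j) /\<^sub>R t) \<longlongrightarrow> (x i - x j) /\<^sub>R lam) (at lam within {b'..M})"
      by (intro tendsto_intros)
    moreover have "isCont \<Phi> ((x i - x j) /\<^sub>R lam)"
      using cont by (simp add: continuous_on_eq_continuous_at)
    ultimately show "((\<lambda>t. scaled_matrix \<Phi> x t $ i $ j) \<longlongrightarrow> scaled_matrix \<Phi> x lam $ i $ j) (at lam within {b'..M})"
      unfolding scaled_matrix_entry by (rule isCont_tendsto_compose[rotated])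
  qed
  then obtain l where l: "l \<in> {b'..M}" "\<And>t. t \<in> {b'..M} \<Longrightarrow> D l \<le> D t"
    using continuous_attains_inf[of "{b'..M}" D] b' by auto
  have "min m0 (D l) \<le> D lam" if "lam \<in> {0<..M}" for lam
  proof (cases "lam < b")
    case True
    then show ?thesis using b(2)[of lam] that by auto
  next
    case False
    then show ?thesis using l(2)[of lam] that b' by auto
  qed
  moreover have "min m0 (D l) > 0" using m0(1) D_pos[of l] l(1) b'(1) by auto
  ultimately show ?thesis unfolding D_def by blast
qed

text \<open>
  The rescaled points \<open>x\<^sub>i / lam\<close> are covered by the bound that is uniform in the points, so one
  constant serves all scales.
\<close>

lemma scaled_matrix_constant_energy_bounded:
  fixes x :: "'n::finite \<Rightarrow> 'a::euclidean_space"
  assumes K: "positive_definite_kernel (\<lambda>u v. \<Phi> (u - v))" and \<Phi>: "integrable lborel \<Phi>"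
    and C: "C > 0" "\<alpha> \<ge> 0"
    and lower: "\<And>\<xi>. C * (1 + (norm \<xi>)\<^sup>2) powr (- \<alpha>) \<le> Re (fourier_transform \<Phi> \<xi>)"
    and x: "inj x"
  obtains B where "\<And>lam. lam > 0 \<Longrightarrow> vec c \<bullet> (matrix_inv (scaled_matrix \<Phi> x lam) *v vec c) \<le> B"
proof -
  obtain B where B: "B > 0"
    "\<And>(z :: 'n \<Rightarrow> 'a) a. (\<Sum>i\<in>UNIV. a i)\<^sup>2 \<le> B * (\<Sum>i\<in>UNIV. \<Sum>j\<in>UNIV. a i * a j * \<Phi> (z i - z j))"
    using sum_squared_le_quadratic_form[OF K \<Phi> finite UNIV_not_empty C lower] by blast
  show thesis
  proof
    fix lam :: real assume lam: "lam > 0"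
    show "vec c \<bullet> (matrix_inv (scaled_matrix \<Phi> x lam) *v vec c) \<le> c\<^sup>2 * B"
    proof (rule inverse_quadratic_form_le)
      show "v \<bullet> (scaled_matrix \<Phi> x lam *v v) > 0" if "v \<noteq> 0" for v
        by (rule scaled_matrix_positive_definite[OF K x lam that])
      show "c\<^sup>2 * B \<ge> 0" using B(1) by simp
      fix v :: "real ^ 'n"
      have "(vec c \<bullet> v)\<^sup>2 = c\<^sup>2 * (\<Sum>i\<in>UNIV. v $ i)\<^sup>2"
        by (simp add: inner_vec_def sum_distrib_left[symmetric] power_mult_distrib)
      also have "\<dots> \<le> c\<^sup>2 * (B * (v \<bullet> (scaled_matrix \<Phi> x lam *v v)))"
        unfolding scaled_matrix_quadratic_form
        by (intro mult_left_mono) (simp_all add: B(2))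
      finally show "(vec c \<bullet> v)\<^sup>2 \<le> c\<^sup>2 * B * (v \<bullet> (scaled_matrix \<Phi> x lam *v v))"
        by (simp add: mult.assoc)
    qed
  qed
qed

section \<open>Minimising sequences of the objective\<close>

lemma ml_scale_infinite_if_unbounded:
  assumes unbdd: "\<And>r. \<exists>t b. t > 0 \<and> l t b \<le> r"
    and bdd: "\<And>M. M > 0 \<Longrightarrow> \<exists>r. \<forall>t b. 0 < t \<and> t \<le> M \<longrightarrow> r \<le> l t b"
  shows "ml_scale_infinite l"
  unfolding ml_scale_infinite_def
proof (intro allI impI, elim conjE)
  fix lam :: "nat \<Rightarrow> real" and \<beta>
  assume pos: "\<forall>k. lam k > 0"
    and lim: "(\<lambda>k. ereal (l (lam k) (\<beta> k))) \<longlonglongrightarrow> (INF (t, b) \<in> {0<..} \<times> UNIV. ereal (l t b))"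
  have "(INF (t, b) \<in> {0<..} \<times> UNIV. ereal (l t b)) = - \<infinity>"
  proof (rule ereal_bot)
    fix r
    obtain t b where tb: "t > 0" "l t b \<le> r" using unbdd by blast
    then show "(INF (t, b) \<in> {0<..} \<times> UNIV. ereal (l t b)) \<le> ereal r"
      by (intro INF_lower2[of "(t, b)"]) auto
  qed
  then have small: "\<forall>\<^sub>F k in sequentially. l (lam k) (\<beta> k) < r" for r
    using lim by (simp add: tendsto_MInfty)
  show "filterlim lam at_top sequentially"
    unfolding filterlim_at_top
  proof
    fix Z
    obtain r where r: "\<And>t b. 0 < t \<Longrightarrow> t \<le> max Z 1 \<Longrightarrow> r \<le> l t b"
      using bdd[of "max Z 1"] by (meson less_max_iff_disj zero_less_one)
    from small[of r] show "\<forall>\<^sub>F k in sequentially. Z \<le> lam k"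
    proof eventually_elim
      case (elim k)
      then show ?case using r[of "lam k" "\<beta> k"] pos by (force simp: not_le)
    qed
  qed
qed

theorem theorem3p3:
  fixes x :: "'n::finite \<Rightarrow> real ^ 'd::finite"
    and \<phi> :: "'q::finite \<Rightarrow> real ^ 'd \<Rightarrow> real"
    and Y :: "real ^ 'n"
    and K :: "real ^ 'd \<Rightarrow> real ^ 'd \<Rightarrow> real"
    and \<Phi> :: "real ^ 'd \<Rightarrow> real"
    and C1 C2 \<alpha> :: real
  assumes "CARD('n) \<ge> 2"
    and "CARD('q) \<le> CARD('n)"
    and "inj x"
    and "\<And>u v. K u v = \<Phi> (u - v)"
    and "positive_definite_kernel K"
    and "continuous_on UNIV \<Phi>"
    and "integrable lborel \<Phi>"
    and "C1 > 0" and "C2 > 0" and "\<alpha> > real CARD('d) / 2"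
    and "\<And>\<xi>. C1 * (1 + (norm \<xi>)\<^sup>2) powr (- \<alpha>) \<le> Re (fourier_transform \<Phi> \<xi>)"
    and "\<And>\<xi>. Re (fourier_transform \<Phi> \<xi>) \<le> C2 * (1 + (norm \<xi>)\<^sup>2) powr (- \<alpha>)"
    and "\<exists>(c::real) (\<beta>s :: real ^ 'q). \<forall>i. Y $ i - (\<Sum>j\<in>UNIV. \<beta>s $ j * \<phi> j (x i)) = c"
  shows "ml_scale_infinite (ml_objective \<Phi> \<phi> x Y)"
proof (rule ml_scale_infinite_if_unbounded)
  have "K = (\<lambda>u v. \<Phi> (u - v))" using assms(4) by (intro ext)
  then have K: "positive_definite_kernel (\<lambda>u v. \<Phi> (u - v))" using assms(5) by simp
  have cont: "isCont \<Phi> u" for u using assms(6) by (simp add: continuous_on_eq_continuous_at)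
  note pd = scaled_matrix_positive_definite[OF K \<open>inj x\<close>]
  have det_pos: "det (scaled_matrix \<Phi> x lam) > 0" if "lam > 0" for lam
    by (rule positive_definite_matrix_det_pos) (rule pd[OF that])
  {
    fix r :: real
    obtain c and \<beta>s :: "real ^ 'q" where "\<And>i. Y $ i - (\<Sum>j\<in>UNIV. \<beta>s $ j * \<phi> j (x i)) = c"
      using assms(13) by blast
    then have residual: "Y - design_matrix \<phi> x *v \<beta>s = vec c"
      by (simp add: vec_eq_iff design_matrix_def matrix_vector_mult_def mult.commute)
    have "\<alpha> \<ge> 0" using assms(10) by (meson less_eq_real_def of_nat_0_le_iff order_trans zero_le_divide_iff zero_le_numeral)
    then obtain B where B: "\<And>lam. lam > 0 \<Longrightarrow> vec c \<bullet> (matrix_inv (scaled_matrix \<Phi> x lam) *v vec c) \<le> B"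
      using scaled_matrix_constant_energy_bounded[OF K assms(7) \<open>C1 > 0\<close> _ assms(11) \<open>inj x\<close>] by blast
    have "\<forall>\<^sub>F lam in at_top. det (scaled_matrix \<Phi> x lam) > 0"
      using eventually_gt_at_top[of 0] by eventually_elim (rule det_pos)
    then have "filterlim (\<lambda>lam. det (scaled_matrix \<Phi> x lam)) (at_right 0) at_top"
      by (rule tendsto_imp_filterlim_at_right[OF det_scaled_matrix_at_top[OF cont assms(1)]])
    then have "filterlim (\<lambda>lam. ln (det (scaled_matrix \<Phi> x lam))) at_bot at_top"
      by (rule filterlim_compose[OF ln_at_0])
    then have "\<forall>\<^sub>F lam in at_top. ln (det (scaled_matrix \<Phi> x lam)) \<le> r - B"
      by (simp add: filterlim_at_bot)
    then have "\<forall>\<^sub>F lam in at_top. lam > 0 \<and> ml_objective \<Phi> \<phi> x Y lam \<beta>s \<le> r"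
      using eventually_gt_at_top[of 0]
    proof eventually_elim
      case (elim lam)
      then show ?case using B[of lam] by (simp add: ml_objective_def residual)
    qed
    then show "\<exists>t b. t > 0 \<and> ml_objective \<Phi> \<phi> x Y t b \<le> r"
      using eventually_happens'[OF trivial_limit_at_top_linorder] by blast
  }
  fix M :: real assume M: "M > 0"
  have "(\<Phi> \<longlongrightarrow> 0) at_infinity"
    using integrable_uniformly_continuous_tendsto_0[OF assms(7)]
      positive_definite_uniformly_continuous[OF K cont] by blast
  then obtain m where m: "m > 0" "\<forall>lam\<in>{0<..M}. m \<le> det (scaled_matrix \<Phi> x lam)"
    using det_scaled_matrix_bounded_below[OF K assms(6) _ \<open>inj x\<close> M] by blast
  have "ln m \<le> ml_objective \<Phi> \<phi> x Y t b" if t: "0 < t" "t \<le> M" for t b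
  proof -
    have "ln m \<le> ln (det (scaled_matrix \<Phi> x t))"
      using m t by (intro ln_mono) auto
    moreover have "0 \<le> (Y - design_matrix \<phi> x *v b) \<bullet>
        (matrix_inv (scaled_matrix \<Phi> x t) *v (Y - design_matrix \<phi> x *v b))"
      by (rule positive_definite_matrix_inv_nonneg) (rule pd[OF t(1)])
    ultimately show ?thesis unfolding ml_objective_def by linarith
  qed
  then show "\<exists>r. \<forall>t b. 0 < t \<and> t \<le> M \<longrightarrow> r \<le> ml_objective \<Phi> \<phi> x Y t b" by blast
qed

end
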